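(* Let $r$, $l$, $m$ be positive integers with $l\ge 2$ and $m\ge 3$, let $G=P_l[K_{1,m,m,m}]$, and let $\delta$ and $\Delta$ denote the minimum and maximum degree of $G$. Then: (i) $\chi_r(G)=4$ for $1\le r\le 3$; (ii) for $4\le r\le \delta-1$, $\chi_r(G)=r+i$ for some integer $i\ge 2$; (iii) if $l=2$, then $\chi_r(G)=2(3m+1)$ for $\delta\le r\le \Delta$; (iv) if $l\neq 2$, then $\chi_r(G)=2(3m+1)$ for $r=\delta$; (v) if $l\neq 2$, then for $\delta+1\le r\le \Delta-m+1$, $\chi_r(G)=2(3m+1)+i$ for some positive integer $i$; (vi) if $l\ge 3$, then $\chi_r(G)=3(3m+1)$ for $\Delta-m+2\le r\le \Delta$.
   Context: All graphs are finite, simple, undirected. An $r$-dynamic $k$-coloring of a graph $G$ is a map $c:V(G)\to\{1,\dots,k\}$ such that $c(u)\neq c(v)$ for every edge $uv$, and for every vertex $v$, $|c(N(v))|\ge \min\{r,d(v)\}$, where $N(v)$ is the set of neighbours of $v$ and $d(v)$ its degree. The $r$-dynamic chromatic number $\chi_r(G)$ is the least $k$ for which an $r$-dynamic $k$-coloring exists. $P_l$ is the path on $l$ vertices. The triple star $K_{1,m,m,m}$ is the tree on $3m+1$ vertices consisting of a center adjacent to $m$ vertices $a_1,\dots,a_m$, where each $a_i$ is adjacent to a vertex $b_i$ which in turn is adjacent to a pendant vertex $c_i$ (so it has $3m$ edges; it is obtained from the double star by attaching one new pendant edge at each of its $m$ pendant vertices). The lexicographic product $G_1[G_2]$ has vertex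 set $V(G_1)\times V(G_2)$, with $(g,h)$ adjacent to $(g',h')$ iff $gg'\in E(G_1)$, or $g=g'$ and $hh'\in E(G_2)$. *)

theory Defs
  imports "Graph_Theory.Pair_Digraph"
begin

text \<open>
  Finite simple undirected graphs are rendered by the locale \<^locale>\<open>pair_graph\<close>: an undirected
  edge is a pair of opposite arcs, and the degree of a vertex is its \<^const>\<open>out_degree\<close>.
\<close>

definition neighbourhood :: "'a pair_pre_digraph \<Rightarrow> 'a \<Rightarrow> 'a set" where
  "neighbourhood G v = {u. (v, u) \<in> parcs G}"

lemma (in pair_graph) out_degree_eq_card_neighbourhood:
  "out_degree G v = card (neighbourhood G v)"
proof -
  have "out_arcs G v = Pair v ` neighbourhood G v"
    by (auto simp: out_arcs_def neighbourhood_def)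
  then show ?thesis
    by (simp add: out_degree_def card_image inj_on_def)
qed

definition min_degree :: "'a pair_pre_digraph \<Rightarrow> nat" where
  "min_degree G = Min (out_degree G ` pverts G)"

definition max_degree :: "'a pair_pre_digraph \<Rightarrow> nat" where
  "max_degree G = Max (out_degree G ` pverts G)"

definition dynamic_coloring :: "nat \<Rightarrow> nat \<Rightarrow> 'a pair_pre_digraph \<Rightarrow> ('a \<Rightarrow> nat) \<Rightarrow> bool" where
  "dynamic_coloring r k G c \<longleftrightarrow>
     (\<forall>v\<in>pverts G. c v \<in> {1..k}) \<and>
     (\<forall>(u, v)\<in>parcs G. c u \<noteq> c v) \<and>
     (\<forall>v\<in>pverts G. card (c ` neighbourhood G v) \<ge> min r (out_degree G v))"

definition dynamic_chromatic_number :: "nat \<Rightarrow> 'a pair_pre_digraph \<Rightarrow> nat" where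
  "dynamic_chromatic_number r G = (LEAST k. \<exists>c. dynamic_coloring r k G c)"

lemma (in pair_graph) dynamic_coloring_exists:
  "\<exists>k c. dynamic_coloring r k G c"
proof -
  obtain c where c: "bij_betw c (pverts G) {1..card (pverts G)}"
    using finite_same_card_bij[of "pverts G" "{1..card (pverts G)}"] pair_finite_verts by auto
  then have inj: "inj_on c (pverts G)"
    by (rule bij_betw_imp_inj_on)
  have sub: "neighbourhood G v \<subseteq> pverts G" for v
    by (auto simp: neighbourhood_def dest: in_arcsD2)
  have "card (c ` neighbourhood G v) = out_degree G v" for v
    using inj_on_subset[OF inj sub]
    by (simp add: card_image out_degree_eq_card_neighbourhood)
  moreover have "c u \<noteq> c v" if "(u, v) \<in> parcs G" for u v
    using that inj in_arcsD1[OF that] in_arcsD2[OF that] pair_no_loops[OF that]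
    by (auto simp: inj_on_eq_iff)
  ultimately have "dynamic_coloring r (card (pverts G)) G c"
    using bij_betwE[OF c] unfolding dynamic_coloring_def by auto
  then show ?thesis by blast
qed

definition path_graph :: "nat \<Rightarrow> nat pair_pre_digraph" where
  "path_graph l =
     \<lparr> pverts = {1..l},
       parcs = {(i, j). i \<in> {1..l} \<and> j \<in> {1..l} \<and> (j = i + 1 \<or> i = j + 1)} \<rparr>"

lemma pair_graph_path_graph: "pair_graph (path_graph l)"
proof
  show "finite (parcs (path_graph l))"
    by (rule finite_subset[of _ "{1..l} \<times> {1..l}"]) (auto simp: path_graph_def)
qed (auto simp: path_graph_def symmetric_def sym_def)

datatype triple_star_vertex = Center | A nat | B nat | C nat

definition triple_star :: "nat \<Rightarrow> triple_star_vertex pair_pre_digraph" where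
  "triple_star m =
     (let E = (\<Union>i\<in>{1..m}. {(Center, A i), (A i, B i), (B i, C i)})
      in \<lparr> pverts = {Center} \<union> A ` {1..m} \<union> B ` {1..m} \<union> C ` {1..m},
           parcs = E \<union> E\<inverse> \<rparr>)"

lemma pair_graph_triple_star: "pair_graph (triple_star m)"
  by standard (auto simp: triple_star_def Let_def symmetric_def sym_def)

lemma card_triple_star: "card (pverts (triple_star m)) = 3 * m + 1"
proof -
  have "card (A ` {1..m} \<union> B ` {1..m} \<union> C ` {1..m}) = m + m + m"
    by (subst card_Un_disjoint; (subst card_Un_disjoint)?)
       (auto simp: card_image inj_on_def)
  moreover have "Center \<notin> A ` {1..m} \<union> B ` {1..m} \<union> C ` {1..m}" by auto
  ultimately show ?thesis
    by (simp add: triple_star_def Let_def)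
qed

definition lex_product ::
  "'a pair_pre_digraph \<Rightarrow> 'b pair_pre_digraph \<Rightarrow> ('a \<times> 'b) pair_pre_digraph" where
  "lex_product G H =
     \<lparr> pverts = pverts G \<times> pverts H,
       parcs = {((g, h), (g', h')). (g, h) \<in> pverts G \<times> pverts H \<and> (g', h') \<in> pverts G \<times> pverts H \<and>
                  ((g, g') \<in> parcs G \<or> g = g' \<and> (h, h') \<in> parcs H)} \<rparr>"

lemma pair_graph_lex_product:
  assumes "pair_graph G" "pair_graph H"
  shows "pair_graph (lex_product G H)"
proof -
  interpret G: pair_graph G by fact
  interpret H: pair_graph H by fact
  have sym: "(v, u) \<in> parcs G" if "(u, v) \<in> parcs G" for u v
    using that G.pair_sym_arcs by (auto simp: symmetric_def dest: symD)
  have sym': "(v, u) \<in> parcs H" if "(u, v) \<in> parcs H" for u v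
    using that H.pair_sym_arcs by (auto simp: symmetric_def dest: symD)
  show ?thesis
  proof
    show "finite (pverts (lex_product G H))"
      by (simp add: lex_product_def G.pair_finite_verts H.pair_finite_verts)
    show "finite (parcs (lex_product G H))"
      by (rule finite_subset[of _ "(pverts G \<times> pverts H) \<times> (pverts G \<times> pverts H)"])
         (auto simp: lex_product_def G.pair_finite_verts H.pair_finite_verts)
    show "symmetric (lex_product G H)"
      by (auto simp: lex_product_def symmetric_def intro!: symI dest: sym sym')
  qed (auto simp: lex_product_def dest: G.pair_no_loops H.pair_no_loops)
qed

end

theory Submission
  imports Defs
begin

text \<open>
  Let \<open>n = 3m + 1\<close> be the order of the triple star. A vertex of \<open>P\<^sub>l[K]\<close> that is a leaf of its copy
  of \<open>K\<close> sees all colours of the adjacent copies and only one further colour. Applied in the first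
  copy, this forces at least \<open>min r (n + 1) - 1\<close> colours on the second copy; applied in the second
  copy, it forces at least \<open>min r (d n + 1) - 1\<close> colours on the first and third copies together,
  where \<open>d\<close> is the degree of the second vertex of the path. These two colour sets are disjoint,
  and the sum of the bounds gives all lower bounds except \<open>\<chi>\<^sub>r \<ge> 4\<close>, which comes from a \<open>K\<^sub>4\<close>. The
  upper bounds come from product colourings: the path is coloured modulo 2 or 3, and the triple
  star either bipartitely or injectively.
\<close>

section \<open>Dynamic colourings\<close>

lemma dynamic_chromatic_number_eqI:
  assumes "dynamic_coloring r k G c"
    and "\<And>k' c'. dynamic_coloring r k' G c' \<Longrightarrow> k \<le> k'"
  shows "dynamic_chromatic_number r G = k"
  unfolding dynamic_chromatic_number_def
  by (rule Least_equality) (use assms in blast)+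

text \<open>By \<open>dynamic_coloring_exists\<close> the \<open>LEAST\<close> is attained, so a
  bound on every colouring passes to it. This settles the claims of the form "plus some
  \<open>i\<close>", for which no optimal colouring is exhibited.\<close>

lemma (in pair_graph) le_dynamic_chromatic_number:
  assumes "\<And>k c. dynamic_coloring r k G c \<Longrightarrow> b \<le> k"
  shows "b \<le> dynamic_chromatic_number r G"
  unfolding dynamic_chromatic_number_def
  using LeastI_ex[OF dynamic_coloring_exists, of r] assms by blast

lemma (in pair_graph) neighbourhood_subset: "neighbourhood G v \<subseteq> pverts G"
  by (auto simp: neighbourhood_def dest: in_arcsD2)

lemma (in pair_graph) finite_neighbourhood: "finite (neighbourhood G v)"
  by (rule finite_subset[OF neighbourhood_subset pair_finite_verts])

lemma (in pair_graph) min_degree_le: "v \<in> pverts G \<Longrightarrow> min_degree G \<le> out_degree G v"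
  by (auto simp: min_degree_def pair_finite_verts)

lemma (in pair_graph) max_degree_ge: "v \<in> pverts G \<Longrightarrow> out_degree G v \<le> max_degree G"
  by (auto simp: max_degree_def pair_finite_verts)

lemma (in pair_graph) min_degree_eqI:
  assumes "v \<in> pverts G" "out_degree G v = d" "\<And>u. u \<in> pverts G \<Longrightarrow> d \<le> out_degree G u"
  shows "min_degree G = d"
  unfolding min_degree_def using assms by (intro Min_eqI) (auto simp: pair_finite_verts)

lemma (in pair_graph) max_degree_eqI:
  assumes "v \<in> pverts G" "out_degree G v = d" "\<And>u. u \<in> pverts G \<Longrightarrow> out_degree G u \<le> d"
  shows "max_degree G = d"
  unfolding max_degree_def using assms by (intro Max_eqI) (auto simp: pair_finite_verts)

lemma (in pair_graph) obtain_min_degree: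
  assumes "pverts G \<noteq> {}"
  obtains v where "v \<in> pverts G" "out_degree G v = min_degree G"
proof -
  have "min_degree G \<in> out_degree G ` pverts G"
    unfolding min_degree_def using assms by (intro Min_in) (auto simp: pair_finite_verts)
  then show thesis by (metis imageE that)
qed

lemma (in pair_graph) obtain_max_degree:
  assumes "pverts G \<noteq> {}"
  obtains v where "v \<in> pverts G" "out_degree G v = max_degree G"
proof -
  have "max_degree G \<in> out_degree G ` pverts G"
    unfolding max_degree_def using assms by (intro Max_in) (auto simp: pair_finite_verts)
  then show thesis by (metis imageE that)
qed

section \<open>Lexicographic products\<close>

lemma pverts_lex_product [simp]: "pverts (lex_product G H) = pverts G \<times> pverts H"
  by (simp add: lex_product_def)

lemma (in pair_graph) not_self_neighbour: "v \<notin> neighbourhood G v"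
  using pair_no_loops[of "(v, v)"] by (auto simp: neighbourhood_def)

context
  fixes G :: "'a pair_pre_digraph" and H :: "'b pair_pre_digraph"
  assumes pair_graph_G: "pair_graph G" and pair_graph_H: "pair_graph H"
begin

interpretation G: pair_graph G by (rule pair_graph_G)
interpretation H: pair_graph H by (rule pair_graph_H)
interpretation P: pair_graph "lex_product G H"
  by (rule pair_graph_lex_product[OF pair_graph_G pair_graph_H])

section \<open>Neighbourhoods and degrees in a lexicographic product\<close>

lemma neighbourhood_lex_product:
  assumes "g \<in> pverts G" "h \<in> pverts H"
  shows "neighbourhood (lex_product G H) (g, h) =
    neighbourhood G g \<times> pverts H \<union> {g} \<times> neighbourhood H h"
  using assms G.neighbourhood_subset[of g] H.neighbourhood_subset[of h]
  by (auto simp: lex_product_def neighbourhood_def)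

lemma out_degree_lex_product:
  assumes "g \<in> pverts G" "h \<in> pverts H"
  shows "out_degree (lex_product G H) (g, h) =
    out_degree G g * card (pverts H) + out_degree H h"
proof -
  \<comment> \<open>The two parts are disjoint because \<open>g\<close> is not its own
    neighbour.\<close>
  have "card (neighbourhood G g \<times> pverts H \<union> {g} \<times> neighbourhood H h) =
      card (neighbourhood G g \<times> pverts H) + card ({g} \<times> neighbourhood H h)"
    by (rule card_Un_disjoint)
      (use G.not_self_neighbour in
        \<open>auto simp: G.finite_neighbourhood H.finite_neighbourhood H.pair_finite_verts\<close>)
  then show ?thesis
    by (simp add: P.out_degree_eq_card_neighbourhood G.out_degree_eq_card_neighbourhood
        H.out_degree_eq_card_neighbourhood neighbourhood_lex_product[OF assms]
        card_cartesian_product)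
qed

text \<open>The degree formula is monotone in the degrees of the two coordinates, which vary
  independently, so a pair of minimisers is a minimiser.\<close>

lemma min_degree_lex_product:
  assumes "pverts G \<noteq> {}" "pverts H \<noteq> {}"
  shows "min_degree (lex_product G H) = min_degree G * card (pverts H) + min_degree H"
proof -
  obtain g h where gh: "g \<in> pverts G" "out_degree G g = min_degree G"
    "h \<in> pverts H" "out_degree H h = min_degree H"
    using G.obtain_min_degree H.obtain_min_degree assms by metis
  show ?thesis
  proof (rule P.min_degree_eqI[of "(g, h)"])
    fix u assume "u \<in> pverts (lex_product G H)"
    then show "min_degree G * card (pverts H) + min_degree H \<le> out_degree (lex_product G H) u"
      by (auto simp: out_degree_lex_product intro!: add_mono mult_right_mono
          G.min_degree_le H.min_degree_le)
  qed (use gh in \<open>auto simp: out_degree_lex_product\<close>)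
qed

lemma max_degree_lex_product:
  assumes "pverts G \<noteq> {}" "pverts H \<noteq> {}"
  shows "max_degree (lex_product G H) = max_degree G * card (pverts H) + max_degree H"
proof -
  obtain g h where gh: "g \<in> pverts G" "out_degree G g = max_degree G"
    "h \<in> pverts H" "out_degree H h = max_degree H"
    using G.obtain_max_degree H.obtain_max_degree assms by metis
  show ?thesis
  proof (rule P.max_degree_eqI[of "(g, h)"])
    fix u assume "u \<in> pverts (lex_product G H)"
    then show "out_degree (lex_product G H) u \<le> max_degree G * card (pverts H) + max_degree H"
      by (auto simp: out_degree_lex_product intro!: add_mono mult_right_mono
          G.max_degree_ge H.max_degree_ge)
  qed (use gh in \<open>auto simp: out_degree_lex_product\<close>)
qed

section \<open>Lower bounds for colourings of a product, and colourings built from the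
  factors\<close>

lemma card_adjacent_layers_ge:
  assumes c: "dynamic_coloring r k (lex_product G H) c"
    and g: "g \<in> pverts G" and h: "h \<in> pverts H" "out_degree H h = 1"
  shows "min r (out_degree G g * card (pverts H) + 1) - 1
    \<le> card (c ` (neighbourhood G g \<times> pverts H))"
proof -
  have "min r (out_degree G g * card (pverts H) + 1)
      \<le> card (c ` neighbourhood (lex_product G H) (g, h))"
    using c g h unfolding dynamic_coloring_def by (force simp: out_degree_lex_product)
  also have "\<dots> \<le> card (c ` (neighbourhood G g \<times> pverts H))
      + card (c ` ({g} \<times> neighbourhood H h))"
    unfolding neighbourhood_lex_product[OF g h(1)] image_Un by (rule card_Un_le)
  \<comment> \<open>The leaf \<open>h\<close> has a single neighbour in its own copy; this one
    colour is the final \<open>- 1\<close> of the claim.\<close>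
  also have "card (c ` ({g} \<times> neighbourhood H h)) \<le> 1"
    using card_image_le[of "{g} \<times> neighbourhood H h" c] h(2) H.finite_neighbourhood[of h]
    by (simp add: H.out_degree_eq_card_neighbourhood card_cartesian_product)
  finally show ?thesis by simp
qed

text \<open>The copy over \<open>g'\<close> is the only layer adjacent to the copy over
  \<open>g\<close>, and it is completely joined to every copy over a neighbour of \<open>g'\<close>.
  Hence the colours counted at \<open>g\<close> and those counted at \<open>g'\<close> form disjoint
  sets, and the two instances of \<open>card_adjacent_layers_ge\<close> add up.\<close>

lemma dynamic_coloring_lower_bound:
  assumes c: "dynamic_coloring r k (lex_product G H) c"
    and g: "g \<in> pverts G" "neighbourhood G g = {g'}"
    and h: "h \<in> pverts H" "out_degree H h = 1"
  shows "(min r (card (pverts H) + 1) - 1) + (min r (out_degree G g' * card (pverts H) + 1) - 1)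
    \<le> k"
proof -
  let ?S = "c ` (neighbourhood G g \<times> pverts H)" and ?T = "c ` (neighbourhood G g' \<times> pverts H)"
  have g': "g' \<in> pverts G"
    using g(2) G.neighbourhood_subset[of g] by auto
  have proper: "c u \<noteq> c v" if "(u, v) \<in> parcs (lex_product G H)" for u v
    using c that unfolding dynamic_coloring_def by auto
  have "?S \<inter> ?T = {}"
  proof -
    have "c (g', x) \<noteq> c (y, z)"
      if "x \<in> pverts H" "y \<in> neighbourhood G g'" "z \<in> pverts H" for x y z
      by (rule proper)
        (use that g' G.neighbourhood_subset[of g'] in
          \<open>auto simp: lex_product_def neighbourhood_def\<close>)
    then show ?thesis unfolding g(2) by fastforce
  qed
  moreover have sub: "?S \<union> ?T \<subseteq> {1..k}"
    using c G.neighbourhood_subset[of g] G.neighbourhood_subset[of g']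
    unfolding dynamic_coloring_def by fastforce
  ultimately have "card ?S + card ?T = card (?S \<union> ?T)"
    by (metis card_Un_disjoint finite_Un finite_atLeastAtMost finite_subset)
  also have "\<dots> \<le> k"
    using card_mono[OF _ sub] by simp
  finally have "card ?S + card ?T \<le> k" .
  moreover have "out_degree G g = 1"
    using g(2) by (simp add: G.out_degree_eq_card_neighbourhood)
  ultimately show ?thesis
    using card_adjacent_layers_ge[OF c g(1) h] card_adjacent_layers_ge[OF c g' h]
    by simp
qed

text \<open>The right-hand side of \<open>dyn\<close> counts the colour pairs seen from
  \<open>(g, h)\<close>. The adjacent copies show every combination of an \<open>a\<close>-colour
  around \<open>g\<close> with a \<open>b\<close>-colour of \<open>H\<close>; the own copy adds the
  \<open>b\<close>-colours around \<open>h\<close>, paired with \<open>a g\<close>.\<close>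

lemma dynamic_coloring_product:
  fixes a :: "'a \<Rightarrow> nat" and b :: "'b \<Rightarrow> nat"
  assumes a: "\<And>g. g \<in> pverts G \<Longrightarrow> a g < q" "\<And>u v. (u, v) \<in> parcs G \<Longrightarrow> a u \<noteq> a v"
    and b: "\<And>h. h \<in> pverts H \<Longrightarrow> b h < s" "\<And>u v. (u, v) \<in> parcs H \<Longrightarrow> b u \<noteq> b v"
    and dyn: "\<And>g h. g \<in> pverts G \<Longrightarrow> h \<in> pverts H \<Longrightarrow>
      min r (out_degree G g * card (pverts H) + out_degree H h)
      \<le> card (a ` neighbourhood G g) * card (b ` pverts H) + card (b ` neighbourhood H h)"
  shows "dynamic_coloring r (q * s) (lex_product G H) (\<lambda>(g, h). a g * s + b h + 1)"
proof -
  \<comment> \<open>A pair of colours becomes a two-digit number whose low digit has base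
    \<open>s\<close>. The digits start at 0 and the colours at 1, hence the
    \<open>+ 1\<close>.\<close>
  define e where "e = (\<lambda>(i, j). i * s + j + 1)"
  have e_inj: "i = i' \<and> j = j'" if "e (i, j) = e (i', j')" "j < s" "j' < s" for i j i' j'
  proof -
    from that have *: "i * s + j = i' * s + j'" by (simp add: e_def)
    then have "(i * s + j) div s = (i' * s + j') div s" by simp
    then have "i = i'" using that by simp
    with * show ?thesis by simp
  qed
  \<comment> \<open>Factoring through \<open>map_prod a b\<close> separates the encoding, which is
    injective on the relevant pairs, from sets of pairs that are products and easy to count.\<close>
  have c: "(\<lambda>(g, h). a g * s + b h + 1) = e \<circ> map_prod a b"
    by (auto simp: e_def fun_eq_iff)
  have range: "e (a g, b h) \<in> {1..q * s}" if "g \<in> pverts G" "h \<in> pverts H" for g h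
  proof -
    have "a g * s + b h + 1 \<le> (a g + 1) * s"
      using b(1)[OF that(2)] by simp
    also have "\<dots> \<le> q * s"
      using a(1)[OF that(1)] by (intro mult_right_mono) auto
    finally show ?thesis by (simp add: e_def)
  qed
  have proper: "e (a g, b h) \<noteq> e (a g', b h')"
    if "((g, h), (g', h')) \<in> parcs (lex_product G H)" for g h g' h'
  proof
    assume "e (a g, b h) = e (a g', b h')"
    moreover have "b h < s" "b h' < s"
      using that b(1) by (auto simp: lex_product_def)
    ultimately have "a g = a g'" "b h = b h'"
      using e_inj by blast+
    with that a(2) b(2) show False
      by (auto simp: lex_product_def)
  qed
  have "min r (out_degree (lex_product G H) (g, h))
      \<le> card ((e \<circ> map_prod a b) ` neighbourhood (lex_product G H) (g, h))"
    if gh: "g \<in> pverts G" "h \<in> pverts H" for g h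
  proof -
    let ?X = "a ` neighbourhood G g \<times> b ` pverts H" and ?Y = "{a g} \<times> b ` neighbourhood H h"
    have "inj_on e (?X \<union> ?Y)"
      using b(1) H.neighbourhood_subset[of h] by (auto intro!: inj_onI dest!: e_inj)
    then have "card (e ` (?X \<union> ?Y)) = card (?X \<union> ?Y)"
      by (rule card_image)
    also have "\<dots> = card ?X + card ?Y"
    proof (rule card_Un_disjoint)
      \<comment> \<open>The first components separate the two sets, since \<open>a\<close> is
        proper.\<close>
      have "a g \<notin> a ` neighbourhood G g"
        using a(2) by (metis imageE mem_Collect_eq neighbourhood_def)
      then show "?X \<inter> ?Y = {}" by (simp add: Times_Int_Times)
    qed (simp_all add: G.finite_neighbourhood H.finite_neighbourhood H.pair_finite_verts)
    finally have "card (e ` (?X \<union> ?Y))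
        = card (a ` neighbourhood G g) * card (b ` pverts H) + card (b ` neighbourhood H h)"
      by (simp add: card_cartesian_product)
    moreover have "(e \<circ> map_prod a b) ` neighbourhood (lex_product G H) (g, h) = e ` (?X \<union> ?Y)"
    proof -
      have "map_prod a b ` (neighbourhood G g \<times> pverts H) = ?X"
        "map_prod a b ` ({g} \<times> neighbourhood H h) = ?Y"
        by force+
      then show ?thesis
        by (simp only: neighbourhood_lex_product[OF gh] image_comp[symmetric] image_Un)
    qed
    ultimately show ?thesis
      using dyn[OF gh] by (simp add: out_degree_lex_product[OF gh])
  qed
  with range proper show ?thesis
    unfolding c dynamic_coloring_def by auto
qed

text \<open>When \<open>b\<close> numbers the vertices of \<open>H\<close> injectively, no colour is
  lost inside a copy. Only repetitions of \<open>a\<close> around \<open>g\<close> can make a vertex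
  see fewer colours than its degree.\<close>

lemma dynamic_coloring_product_injective:
  fixes a :: "'a \<Rightarrow> nat"
  assumes a: "\<And>g. g \<in> pverts G \<Longrightarrow> a g < q" "\<And>u v. (u, v) \<in> parcs G \<Longrightarrow> a u \<noteq> a v"
    and dyn: "\<And>g h. g \<in> pverts G \<Longrightarrow> h \<in> pverts H \<Longrightarrow>
      min r (out_degree G g * card (pverts H) + out_degree H h)
      \<le> card (a ` neighbourhood G g) * card (pverts H) + out_degree H h"
  shows "\<exists>c. dynamic_coloring r (q * card (pverts H)) (lex_product G H) c"
proof -
  obtain b where b: "bij_betw b (pverts H) {0..<card (pverts H)}"
    using ex_bij_betw_finite_nat[OF H.pair_finite_verts] by blast
  then have inj: "inj_on b (pverts H)"
    by (rule bij_betw_imp_inj_on)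
  have nbr: "card (b ` neighbourhood H h) = out_degree H h" for h
    using inj_on_subset[OF inj H.neighbourhood_subset]
    by (simp add: card_image H.out_degree_eq_card_neighbourhood)
  have "dynamic_coloring r (q * card (pverts H)) (lex_product G H)
      (\<lambda>(g, h). a g * card (pverts H) + b h + 1)"
  proof (rule dynamic_coloring_product)
    fix u v assume "(u, v) \<in> parcs H"
    then show "b u \<noteq> b v"
      using inj H.pair_no_loops[of "(u, v)"] H.in_arcsD1[of u v] H.in_arcsD2[of u v]
      by (auto simp: inj_on_eq_iff)
  qed (use a dyn bij_betwE[OF b] in \<open>auto simp: nbr card_image[OF inj]\<close>)
  then show ?thesis by blast
qed

end

section \<open>Paths and triple stars\<close>

lemma pverts_path_graph [simp]: "pverts (path_graph l) = {1..l}"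
  by (simp add: path_graph_def)

lemma neighbourhood_path_graph:
  "neighbourhood (path_graph l) i =
    (if i \<in> {1..l} then {j \<in> {1..l}. j = i + 1 \<or> i = j + 1} else {})"
  by (auto simp: neighbourhood_def path_graph_def)

lemma neighbourhood_path_graph_1: "l \<ge> 2 \<Longrightarrow> neighbourhood (path_graph l) 1 = {2}"
  by (auto simp: neighbourhood_path_graph)

lemma neighbourhood_path_graph_2:
  "l \<ge> 2 \<Longrightarrow> neighbourhood (path_graph l) 2 = (if l = 2 then {1} else {1, 3})"
  by (auto simp: neighbourhood_path_graph)

lemma neighbourhood_path_graph_nonempty:
  assumes "l \<ge> 2" "i \<in> {1..l}"
  shows "neighbourhood (path_graph l) i \<noteq> {}"
proof (cases "i = 1")
  case False
  with assms have "i - 1 \<in> neighbourhood (path_graph l) i"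
    by (auto simp: neighbourhood_path_graph)
  then show ?thesis by blast
qed (use assms neighbourhood_path_graph_1 in auto)

lemma out_degree_path_graph: "out_degree (path_graph l) i = card (neighbourhood (path_graph l) i)"
  by (rule pair_graph.out_degree_eq_card_neighbourhood[OF pair_graph_path_graph])

lemma out_degree_path_graph_2:
  "l \<ge> 2 \<Longrightarrow> out_degree (path_graph l) 2 = (if l = 2 then 1 else 2)"
  by (simp add: out_degree_path_graph neighbourhood_path_graph_2)

lemma out_degree_path_graph_bounds:
  assumes "l \<ge> 2" "i \<in> {1..l}"
  shows "1 \<le> out_degree (path_graph l) i" "out_degree (path_graph l) i \<le> (if l = 2 then 1 else 2)"
proof -
  show "1 \<le> out_degree (path_graph l) i"
    using neighbourhood_path_graph_nonempty[OF assms]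
      pair_graph.finite_neighbourhood[OF pair_graph_path_graph, of l i]
    by (simp add: out_degree_path_graph Suc_le_eq card_gt_0_iff)
  show "out_degree (path_graph l) i \<le> (if l = 2 then 1 else 2)"
  proof (cases "l = 2")
    case True
    \<comment> \<open>On the path with vertices 1 and 2, the map \<open>3 - i\<close> exchanges the
      two.\<close>
    have "neighbourhood (path_graph l) i \<subseteq> {3 - i}"
      using True by (auto simp: neighbourhood_path_graph)
    from card_mono[OF _ this] True show ?thesis
      by (simp add: out_degree_path_graph)
  next
    case False
    have "neighbourhood (path_graph l) i \<subseteq> {i - 1, i + 1}"
      by (auto simp: neighbourhood_path_graph)
    from card_mono[OF _ this] False show ?thesis
      by (auto simp: out_degree_path_graph card_insert_if split: if_splits)
  qed
qed

lemma min_degree_path_graph: "l \<ge> 2 \<Longrightarrow> min_degree (path_graph l) = 1"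
  by (rule pair_graph.min_degree_eqI[OF pair_graph_path_graph, of 1])
    (use out_degree_path_graph_bounds in
      \<open>auto simp: out_degree_path_graph neighbourhood_path_graph_1[unfolded One_nat_def]\<close>)

text \<open>Vertex \<open>2\<close> is an endpoint if \<open>l = 2\<close> and interior otherwise,
  so it realises the maximum in both cases.\<close>

lemma max_degree_path_graph: "l \<ge> 2 \<Longrightarrow> max_degree (path_graph l) = (if l = 2 then 1 else 2)"
  by (rule pair_graph.max_degree_eqI[OF pair_graph_path_graph, of 2])
    (use out_degree_path_graph_2 out_degree_path_graph_bounds in \<open>auto split: if_splits\<close>)

lemma path_graph_mod_proper:
  assumes "(u, v) \<in> parcs (path_graph l)" "q \<ge> 2"
  shows "u mod q \<noteq> v mod q"
proof -
  have "Suc i mod q \<noteq> i mod q" for i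
    using assms(2) by (auto simp: mod_Suc)
  with assms show ?thesis
    by (auto simp: path_graph_def) metis
qed

text \<open>Two neighbours of the same vertex differ by 0 or 2, and 3 does not divide 2. Thus three
  residues tell the neighbours of a path vertex apart, which two residues cannot do at an interior
  vertex.\<close>

lemma inj_on_mod3_neighbourhood_path_graph: "inj_on (\<lambda>i. i mod 3) (neighbourhood (path_graph l) i)"
proof (rule inj_onI)
  fix x y assume "x \<in> neighbourhood (path_graph l) i" "y \<in> neighbourhood (path_graph l) i"
    and eq: "x mod 3 = y mod 3"
  then have "x = y \<or> x = y + 2 \<or> y = x + 2"
    by (auto simp: neighbourhood_path_graph split: if_splits)
  with eq show "x = y" by presburger
qed

section \<open>Triple stars: degrees and bipartition\<close>

lemma pverts_triple_star:
  "pverts (triple_star m) = {Center} \<union> A ` {1..m} \<union> B ` {1..m} \<union> C ` {1..m}"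
  by (simp add: triple_star_def Let_def)

lemma neighbourhood_triple_star:
  "neighbourhood (triple_star m) Center = A ` {1..m}"
  "i \<in> {1..m} \<Longrightarrow> neighbourhood (triple_star m) (A i) = {Center, B i}"
  "i \<in> {1..m} \<Longrightarrow> neighbourhood (triple_star m) (B i) = {A i, C i}"
  "i \<in> {1..m} \<Longrightarrow> neighbourhood (triple_star m) (C i) = {B i}"
  by (auto simp: neighbourhood_def triple_star_def Let_def)

lemma out_degree_triple_star:
  "out_degree (triple_star m) Center = m"
  "i \<in> {1..m} \<Longrightarrow> out_degree (triple_star m) (A i) = 2"
  "i \<in> {1..m} \<Longrightarrow> out_degree (triple_star m) (B i) = 2"
  "i \<in> {1..m} \<Longrightarrow> out_degree (triple_star m) (C i) = 1"
  unfolding pair_graph.out_degree_eq_card_neighbourhood[OF pair_graph_triple_star]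
  by (simp_all add: neighbourhood_triple_star card_image inj_on_def)

lemma min_degree_triple_star: "m \<ge> 1 \<Longrightarrow> min_degree (triple_star m) = 1"
  by (rule pair_graph.min_degree_eqI[OF pair_graph_triple_star, of "C 1"])
    (auto simp: pverts_triple_star out_degree_triple_star)

lemma max_degree_triple_star: "m \<ge> 2 \<Longrightarrow> max_degree (triple_star m) = m"
  by (rule pair_graph.max_degree_eqI[OF pair_graph_triple_star, of Center])
    (auto simp: pverts_triple_star out_degree_triple_star)

text \<open>The bipartition of the tree, given by the parity of the distance from
  \<open>Center\<close>.\<close>

fun triple_star_side :: "triple_star_vertex \<Rightarrow> nat" where
  "triple_star_side Center = 0"
| "triple_star_side (A i) = 1"
| "triple_star_side (B i) = 0"
| "triple_star_side (C i) = 1"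

lemma triple_star_side_less: "triple_star_side h < 2"
  by (cases h) auto

lemma triple_star_side_proper:
  "(u, v) \<in> parcs (triple_star m) \<Longrightarrow> triple_star_side u \<noteq> triple_star_side v"
  by (auto simp: triple_star_def Let_def)

section \<open>The product of a path and a triple star\<close>

abbreviation (input) path_star :: "nat \<Rightarrow> nat \<Rightarrow> (nat \<times> triple_star_vertex) pair_pre_digraph" where
  "path_star l m \<equiv> lex_product (path_graph l) (triple_star m)"

lemmas path_star_factors = pair_graph_path_graph pair_graph_triple_star

section \<open>Extremal degrees of the product\<close>

lemma min_degree_path_star:
  assumes "l \<ge> 2" "m \<ge> 1"
  shows "min_degree (path_star l m) = 3 * m + 2"
proof -
  have "pverts (path_graph l) \<noteq> {}" "pverts (triple_star m) \<noteq> {}"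
    using assms by (auto simp: pverts_triple_star)
  from min_degree_lex_product[OF path_star_factors this] show ?thesis
    using assms by (simp add: card_triple_star min_degree_path_graph min_degree_triple_star)
qed

lemma max_degree_path_star:
  assumes "l \<ge> 2" "m \<ge> 2"
  shows "max_degree (path_star l m) = (if l = 2 then 1 else 2) * (3 * m + 1) + m"
proof -
  have "pverts (path_graph l) \<noteq> {}" "pverts (triple_star m) \<noteq> {}"
    using assms by (auto simp: pverts_triple_star)
  from max_degree_lex_product[OF path_star_factors this] show ?thesis
    using assms by (simp only: card_triple_star max_degree_path_graph max_degree_triple_star)
qed

section \<open>Lower bounds on the number of colours\<close>

lemma path_star_dynamic_coloring_ge:
  assumes "dynamic_coloring r k (path_star l m) c" "l \<ge> 2" "m \<ge> 1"
  shows "(min r (3 * m + 2) - 1) + (min r ((if l = 2 then 1 else 2) * (3 * m + 1) + 1) - 1) \<le> k"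
proof -
  \<comment> \<open>The general bound is applied to the endpoint \<open>1\<close> of the path, its
    neighbour \<open>2\<close>, and the leaf \<open>C 1\<close> of the star.\<close>
  have "1 \<in> pverts (path_graph l)"
    using assms(2) by simp
  moreover have "C 1 \<in> pverts (triple_star m)" "out_degree (triple_star m) (C 1) = 1"
    using assms(3) by (auto simp: pverts_triple_star out_degree_triple_star)
  ultimately have "(min r (3 * m + 1 + 1) - 1)
      + (min r (out_degree (path_graph l) 2 * (3 * m + 1) + 1) - 1) \<le> k"
    using dynamic_coloring_lower_bound[OF path_star_factors assms(1)]
      neighbourhood_path_graph_1[OF assms(2)]
    unfolding card_triple_star by blast
  then show ?thesis
    by (simp only: out_degree_path_graph_2[OF assms(2)] add.assoc one_add_one)
qed

text \<open>An edge of the path and an edge of the star together span a complete graph on four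
  vertices. This covers \<open>r = 1\<close> and \<open>r = 2\<close>, where
  \<open>path_star_dynamic_coloring_ge\<close> yields only 0 and 2.\<close>

lemma path_star_dynamic_coloring_ge_4:
  assumes "dynamic_coloring r k (path_star l m) c" "l \<ge> 2" "m \<ge> 1"
  shows "4 \<le> k"
proof -
  let ?K = "{(1, Center), (1, A 1), (2, Center), (2, A 1)}"
  have proper: "c u \<noteq> c v" if "(u, v) \<in> parcs (path_star l m)" for u v
    using assms(1) that unfolding dynamic_coloring_def by auto
  have "c u \<noteq> c v" if "u \<in> ?K" "v \<in> ?K" "u \<noteq> v" for u v
    by (rule proper)
      (use that assms(2,3) in
        \<open>auto simp: lex_product_def path_graph_def triple_star_def Let_def\<close>)
  then have "inj_on c ?K"
    by (meson inj_onI)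
  then have "card (c ` ?K) = 4"
    by (subst card_image) auto
  moreover have "c ` ?K \<subseteq> {1..k}"
    using assms unfolding dynamic_coloring_def by (auto simp: pverts_triple_star)
  then have "card (c ` ?K) \<le> k"
    using card_mono[of "{1..k}" "c ` ?K"] by simp
  ultimately show ?thesis by simp
qed

section \<open>Explicit colourings for the upper bounds\<close>

lemma card_image_neighbourhood_path_graph_ge:
  assumes "l \<ge> 2" "i \<in> {1..l}"
  shows "1 \<le> card (f ` neighbourhood (path_graph l) i)"
  using neighbourhood_path_graph_nonempty[OF assms]
    pair_graph.finite_neighbourhood[OF pair_graph_path_graph, of l i]
  by (simp add: Suc_le_eq card_gt_0_iff)

lemma out_degree_triple_star_ge:
  assumes "h \<in> pverts (triple_star m)" "m \<ge> 1"
  shows "1 \<le> out_degree (triple_star m) h"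
  using assms by (auto simp: pverts_triple_star out_degree_triple_star)

lemma path_star_dynamic_4_coloring:
  assumes "l \<ge> 2" "m \<ge> 1" "r \<le> 3"
  shows "\<exists>c. dynamic_coloring r 4 (path_star l m) c"
proof -
  let ?b = "triple_star_side"
  have "dynamic_coloring r (2 * 2) (path_star l m) (\<lambda>(g, h). g mod 2 * 2 + ?b h + 1)"
  proof (rule dynamic_coloring_product[OF path_star_factors])
    fix g h assume g: "g \<in> pverts (path_graph l)" and h: "h \<in> pverts (triple_star m)"
    let ?N = "card ((\<lambda>g. g mod 2) ` neighbourhood (path_graph l) g)"
    have "Center \<in> pverts (triple_star m)" "A 1 \<in> pverts (triple_star m)"
      using assms(2) by (auto simp: pverts_triple_star)
    then have "{0, 1} \<subseteq> ?b ` pverts (triple_star m)"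
      by (metis empty_subsetI imageI insert_subset triple_star_side.simps(1,2))
    then have "card {0, 1 :: nat} \<le> card (?b ` pverts (triple_star m))"
      by (intro card_mono finite_imageI) (auto simp: pverts_triple_star)
    moreover have "1 \<le> card (?b ` neighbourhood (triple_star m) h)"
      using out_degree_triple_star_ge[OF h assms(2)]
        pair_graph.finite_neighbourhood[OF pair_graph_triple_star, of m h]
      by (auto simp: pair_graph.out_degree_eq_card_neighbourhood[OF pair_graph_triple_star]
          Suc_le_eq card_gt_0_iff)
    moreover have "1 \<le> ?N"
      using card_image_neighbourhood_path_graph_ge assms(1) g by simp
    \<comment> \<open>Each vertex sees both sides of an adjacent copy and at least one colour of its
      own copy: three colours, as many as \<open>r \<le> 3\<close> can demand.\<close>
    ultimately have "1 * 2 + 1 \<le> ?N * card (?b ` pverts (triple_star m))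
        + card (?b ` neighbourhood (triple_star m) h)"
      by (intro add_mono mult_mono) auto
    with assms(3) show "min r (out_degree (path_graph l) g * card (pverts (triple_star m))
          + out_degree (triple_star m) h)
        \<le> ?N * card (?b ` pverts (triple_star m)) + card (?b ` neighbourhood (triple_star m) h)"
      by linarith
  qed (auto dest: path_graph_mod_proper[where q = 2] triple_star_side_proper
      simp: triple_star_side_less)
  then show ?thesis by auto
qed

text \<open>Modulo 2, each vertex sees at least one full block of \<open>3 * m + 1\<close> colours,
  and from its own copy as many more as its degree there. For \<open>l = 2\<close> this is its whole
  degree; otherwise it is at least \<open>3 * m + 2\<close>, as every star vertex has a
  neighbour.\<close>

lemma path_star_dynamic_coloring_two_blocks:
  assumes "l \<ge> 2" "m \<ge> 1" "l = 2 \<or> r \<le> 3 * m + 2"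
  shows "\<exists>c. dynamic_coloring r (2 * (3 * m + 1)) (path_star l m) c"
  unfolding card_triple_star[symmetric]
proof (rule dynamic_coloring_product_injective[OF path_star_factors, where a = "\<lambda>g. g mod 2"])
  fix g h assume g: "g \<in> pverts (path_graph l)" and h: "h \<in> pverts (triple_star m)"
  let ?N = "card ((\<lambda>g. g mod 2) ` neighbourhood (path_graph l) g)"
  let ?n = "card (pverts (triple_star m))"
  have N: "1 \<le> ?N"
    using card_image_neighbourhood_path_graph_ge assms(1) g by simp
  have "min r (out_degree (path_graph l) g * ?n + out_degree (triple_star m) h)
      \<le> 1 * ?n + out_degree (triple_star m) h"
    using assms(3)
  proof
    assume "l = 2"
    then have "out_degree (path_graph l) g \<le> 1"
      using out_degree_path_graph_bounds(2)[of l g] g by simp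
    then have "out_degree (path_graph l) g * ?n \<le> 1 * ?n"
      by (rule mult_right_mono) simp
    then show ?thesis by (intro min.coboundedI2 add_right_mono)
  next
    assume "r \<le> 3 * m + 2"
    with out_degree_triple_star_ge[OF h assms(2)] show ?thesis
      by (simp add: card_triple_star)
  qed
  also have "\<dots> \<le> ?N * ?n + out_degree (triple_star m) h"
    using mult_right_mono[OF N, of ?n] by simp
  finally show "min r (out_degree (path_graph l) g * ?n + out_degree (triple_star m) h)
      \<le> ?N * ?n + out_degree (triple_star m) h" .
qed (auto dest: path_graph_mod_proper[where q = 2])

text \<open>Modulo 3 the copies adjacent to a given one use different blocks, so every vertex sees
  as many colours as it has neighbours. The colouring is therefore dynamic for every
  \<open>r\<close>.\<close>

lemma path_star_dynamic_coloring_three_blocks: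
  "\<exists>c. dynamic_coloring r (3 * (3 * m + 1)) (path_star l m) c"
  unfolding card_triple_star[symmetric]
  by (rule dynamic_coloring_product_injective[OF path_star_factors, where a = "\<lambda>g. g mod 3"])
    (auto dest: path_graph_mod_proper[where q = 3]
      simp: card_image[OF inj_on_mod3_neighbourhood_path_graph] out_degree_path_graph)

section \<open>The six ranges of \<open>r\<close>\<close>

theorem theorem4:
  fixes r l m \<delta> \<Delta> :: nat
    and G :: "(nat \<times> triple_star_vertex) pair_pre_digraph"
  assumes "r \<ge> 1" and "l \<ge> 2" and "m \<ge> 3"
    and "G = lex_product (path_graph l) (triple_star m)"
    and "\<delta> = min_degree G"
    and "\<Delta> = max_degree G"
  shows "(1 \<le> r \<and> r \<le> 3 \<longrightarrow> dynamic_chromatic_number r G = 4) \<and>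
    (4 \<le> r \<and> r \<le> \<delta> - 1 \<longrightarrow> (\<exists>i\<ge>2. dynamic_chromatic_number r G = r + i)) \<and>
    (l = 2 \<longrightarrow> \<delta> \<le> r \<and> r \<le> \<Delta> \<longrightarrow> dynamic_chromatic_number r G = 2 * (3 * m + 1)) \<and>
    (l \<noteq> 2 \<longrightarrow> r = \<delta> \<longrightarrow> dynamic_chromatic_number r G = 2 * (3 * m + 1)) \<and>
    (l \<noteq> 2 \<longrightarrow> \<delta> + 1 \<le> r \<and> r \<le> \<Delta> - m + 1 \<longrightarrow>
       (\<exists>i\<ge>1. dynamic_chromatic_number r G = 2 * (3 * m + 1) + i)) \<and>
    (l \<ge> 3 \<longrightarrow> \<Delta> - m + 2 \<le> r \<and> r \<le> \<Delta> \<longrightarrow>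
       dynamic_chromatic_number r G = 3 * (3 * m + 1))"
proof -
  define n where "n = 3 * m + 1"
  define d :: nat where "d = (if l = 2 then 1 else 2)"
  note G = assms(4)
  have \<delta>: "\<delta> = n + 1"
    using min_degree_path_star[of l m] assms by (simp add: n_def)
  have \<Delta>: "\<Delta> = d * n + m"
    using max_degree_path_star[of l m] assms by (simp only: n_def d_def)
  \<comment> \<open>For the linear arithmetic below, \<open>d * n\<close> is an atom; this
    inequality relates it to \<open>n\<close>.\<close>
  have n: "n \<le> d * n"
    by (simp add: d_def)
  have lower: "(min r (n + 1) - 1) + (min r (d * n + 1) - 1) \<le> k"
    if "dynamic_coloring r k G c" for k c
    using path_star_dynamic_coloring_ge[OF that[unfolded G] assms(2)] assms(3)
    by (simp add: n_def d_def)
  have lower': "(min r (n + 1) - 1) + (min r (d * n + 1) - 1) \<le> dynamic_chromatic_number r G"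
    unfolding G
    by (rule pair_graph.le_dynamic_chromatic_number[OF pair_graph_lex_product[OF path_star_factors]])
      (use lower G in blast)
  have "dynamic_chromatic_number r G = 4" if "r \<le> 3"
    using path_star_dynamic_4_coloring[OF assms(2) _ that, of m]
      path_star_dynamic_coloring_ge_4[OF _ assms(2), of r _ m] assms(3)
    unfolding G by (auto intro: dynamic_chromatic_number_eqI)
  moreover have "\<exists>i\<ge>2. dynamic_chromatic_number r G = r + i" if "4 \<le> r" "r \<le> \<delta> - 1"
  proof -
    \<comment> \<open>Here \<open>r \<le> n\<close>, so both minima in \<open>lower'\<close> equal
      \<open>r\<close> and the bound is \<open>2 * r - 2\<close>, which is at least
      \<open>r + 2\<close> because \<open>r \<ge> 4\<close>.\<close>
    have "r + 2 \<le> dynamic_chromatic_number r G"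
      using lower' that n unfolding \<delta> by linarith
    then show ?thesis
      by (intro exI[of _ "dynamic_chromatic_number r G - r"]) auto
  qed
  \<comment> \<open>Claims (iii) and (iv) together. From \<open>r \<ge> n + 1\<close> on, the first
    summand of \<open>lower\<close> is \<open>n\<close> and the second is at least
    \<open>n\<close>.\<close>
  moreover have "dynamic_chromatic_number r G = 2 * n" if "\<delta> \<le> r" "l = 2 \<or> r = \<delta>"
  proof -
    have "l = 2 \<or> r \<le> 3 * m + 2"
      using that \<delta> by (auto simp: n_def)
    then obtain c where c: "dynamic_coloring r (2 * n) G c"
      using path_star_dynamic_coloring_two_blocks[of l m r] assms unfolding n_def by auto
    have "2 * n \<le> k" if "dynamic_coloring r k G c" for k c
      using lower[OF that] \<open>\<delta> \<le> r\<close> n unfolding \<delta> by linarith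
    with c show ?thesis by (rule dynamic_chromatic_number_eqI)
  qed
  moreover have "\<exists>i\<ge>1. dynamic_chromatic_number r G = 2 * n + i" if "l \<noteq> 2" "\<delta> + 1 \<le> r"
  proof -
    \<comment> \<open>With \<open>d = 2\<close> and \<open>r \<ge> n + 2\<close>, the second summand
      of \<open>lower'\<close> exceeds \<open>n\<close>, while the first is still
      \<open>n\<close>.\<close>
    have "2 * n + 1 \<le> dynamic_chromatic_number r G"
      using lower' that by (simp add: \<delta> d_def n_def min_def split: if_splits)
    then show ?thesis
      by (intro exI[of _ "dynamic_chromatic_number r G - 2 * n"]) auto
  qed
  moreover have "dynamic_chromatic_number r G = 3 * n" if "l \<ge> 3" "\<Delta> - m + 2 \<le> r"
  proof -
    obtain c where c: "dynamic_coloring r (3 * n) G c"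
      using path_star_dynamic_coloring_three_blocks[of r m l] unfolding n_def G by blast
    \<comment> \<open>Now \<open>r \<ge> 2 * n + 2\<close>, so both minima are saturated and the
      summands are \<open>n\<close> and \<open>2 * n\<close>.\<close>
    have "3 * n \<le> k" if "dynamic_coloring r k G c" for k c
      using lower[OF that] \<open>l \<ge> 3\<close> \<open>\<Delta> - m + 2 \<le> r\<close>
      by (simp add: \<Delta> d_def min_def split: if_splits)
    with c show ?thesis by (rule dynamic_chromatic_number_eqI)
  qed
  ultimately show ?thesis
    unfolding n_def[symmetric] by blast
qed

end
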